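(* Let $\mathcal{F}_n^{k,s}$ be an NBB fractal family with $s\ge2$ and $1\le k<s^2$, and let $\mathcal{H}=\log(k)/\log(s)$. Processing the fractal with the map $\lambda(\omega)$ requires asymptotically less work than the bounding-box approach. That is, let $W_{BB}(n)$ be the total cost of mapping all blocks of the bounding-box parallel space $\Pi_{BB}^2$ and let $W_{\lambda}(n)$ be the total cost of mapping all blocks of the parallel space $\Pi_{\lambda(\omega)}^2$ using $\lambda$. Then the work improvement factor $$S_{\lambda(\omega)}(n)=\frac{W_{BB}(n)}{W_{\lambda}(n)}$$ satisfies $\lim_{n\to\infty}S_{\lambda(\omega)}(n)=\infty$.
   Context: NBB (Non-overlapping Bottom-up Boxes) fractals: given integers $s\ge2$ (scale-up factor), $k\ge1$ (number of replicas) and $k$ distinct replica offsets $\tau_0,\dots,\tau_{k-1}\in\{0,\dots,s-1\}^2$, the fractal of linear size $n=s^r$ is the finite set $\mathcal{F}_n^{k,s}\subset\{0,\dots,n-1\}^2$ defined by $\mathcal{F}_1^{k,s}=\{(0,0)\}$ and $\mathcal{F}_{sn}^{k,s}=\bigcup_{i=0}^{k-1}\left(\mathcal{F}_n^{k,s}+n\,\tau_i\right)$. The bounding boxes of the $k$ replicas do not overlap. Its Hausdorff dimension is $\mathcal{H}=\log(k)/\log(s)$. Block-space: threads are grouped in blocks of $b\times b$ threads with $b$ a constant, and blocks are mapped onto the coarsened fractal $\mathcal{F}_{n_b}^{k,s}$ with $n_b=n/b=s^{r_b}$, so $n_b\in\Theta(n)$. Bounding-box approach: the parallel space $\Pi_{BB}^2$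 is the box of $n_b\times n_b$ blocks, mapped with the identity $f(\omega)=\omega$ at constant (positive) cost per block; thus $W_{BB}(n)$ equals a positive constant times $n_b^2$. $\lambda(\omega)$ approach: the parallel space $\Pi_{\lambda(\omega)}^2$ is the $2$-orthotope (discrete rectangle) of $k^{\lceil r_b/2\rceil}\times k^{\lfloor r_b/2\rfloor}$ blocks, so that its number of blocks is $\mathcal{O}(n^{\mathcal{H}})$. It is mapped onto $\mathcal{F}_{n_b}^{k,s}$ by $\lambda$, the map sending $\omega=(\omega_x,\omega_y)$ to $\lambda(\omega)=\sum_{\mu=1}^{r_b}s^{\mu-1}\,\tau_{\beta_\mu(\omega)}$, where $\beta_\mu(\omega)=\left\lfloor\frac{\omega_x(\mu\bmod 2)+\omega_y((\mu+1)\bmod 2)}{k^{\lceil\mu/2\rceil-1}}\right\rfloor\bmod k$. The cost per block is its parallel evaluation time, which is $\mathcal{O}(\log_2\log_2(n))$. Thus $W_{\lambda}(n)=\mathcal{O}(\log_2\log_2(n))\cdot k^{r_b}$ (the cost of a block being counted as its mapping time, not time multiplied by threads). *)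

theory Defs
  imports Complex_Main "HOL-Library.Product_Plus" "HOL-Library.Landau_Symbols"
begin

definition scale :: "nat \<Rightarrow> nat \<times> nat \<Rightarrow> nat \<times> nat" where
  "scale a p = (a * fst p, a * snd p)"

text \<open>Only the values of \<open>\<tau>\<close> below \<open>k\<close> matter.\<close>

definition nbb_family :: "nat \<Rightarrow> nat \<Rightarrow> (nat \<Rightarrow> nat \<times> nat) \<Rightarrow> bool" where
  "nbb_family s k \<tau> \<longleftrightarrow>
     s \<ge> 2 \<and> k \<ge> 1 \<and> inj_on \<tau> {..<k} \<and> \<tau> ` {..<k} \<subseteq> {..<s} \<times> {..<s}"

text \<open>The fractal is indexed by its level: \<open>nbb_fractal s k \<tau> r\<close> has linear size \<open>s ^ r\<close>.\<close>

primrec nbb_fractal :: "nat \<Rightarrow> nat \<Rightarrow> (nat \<Rightarrow> nat \<times> nat) \<Rightarrow> nat \<Rightarrow> (nat \<times> nat) set" where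
  "nbb_fractal s k \<tau> 0 = {(0, 0)}"
| "nbb_fractal s k \<tau> (Suc r) =
     (\<Union>i<k. (\<lambda>p. p + scale (s ^ r) (\<tau> i)) ` nbb_fractal s k \<tau> r)"

definition nbb_dim :: "nat \<Rightarrow> nat \<Rightarrow> real" where
  "nbb_dim s k = ln (real k) / ln (real s)"

text \<open>The exponent \<open>r\<close> with \<open>n = s ^ r\<close>; meaningful only if \<open>n\<close> is a power of \<open>s\<close>.\<close>

definition level :: "nat \<Rightarrow> nat \<Rightarrow> nat" where
  "level s n = (THE r. s ^ r = n)"

definition bb_space :: "nat \<Rightarrow> (nat \<times> nat) set" where
  "bb_space nb = {..<nb} \<times> {..<nb}"

text \<open>On naturals, \<open>(r + 1) div 2\<close> and \<open>r div 2\<close> are the ceiling and the floor of \<open>r / 2\<close>.\<close>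

definition lambda_space :: "nat \<Rightarrow> nat \<Rightarrow> (nat \<times> nat) set" where
  "lambda_space k rb = {..<k ^ ((rb + 1) div 2)} \<times> {..<k ^ (rb div 2)}"

definition beta :: "nat \<Rightarrow> nat \<Rightarrow> nat \<times> nat \<Rightarrow> nat" where
  "beta k \<mu> \<omega> =
     ((fst \<omega> * (\<mu> mod 2) + snd \<omega> * ((\<mu> + 1) mod 2)) div k ^ ((\<mu> + 1) div 2 - 1)) mod k"

definition lambda_map :: "nat \<Rightarrow> nat \<Rightarrow> (nat \<Rightarrow> nat \<times> nat) \<Rightarrow> nat \<Rightarrow> nat \<times> nat \<Rightarrow> nat \<times> nat" where
  "lambda_map s k \<tau> rb \<omega> = (\<Sum>\<mu>=1..rb. scale (s ^ (\<mu> - 1)) (\<tau> (beta k \<mu> \<omega>)))"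

text \<open>
  A cost function \<open>cost\<close> is left abstract: \<open>cost n f \<omega>\<close> is the cost of mapping the single block
  \<open>\<omega>\<close> with the map \<open>f\<close> when the fractal has linear size \<open>n\<close>.
\<close>

type_synonym block_map = "nat \<times> nat \<Rightarrow> nat \<times> nat"
type_synonym block_cost = "nat \<Rightarrow> block_map \<Rightarrow> nat \<times> nat \<Rightarrow> real"

definition mapping_work :: "block_cost \<Rightarrow> nat \<Rightarrow> block_map \<Rightarrow> (nat \<times> nat) set \<Rightarrow> real" where
  "mapping_work cost n f P = (\<Sum>\<omega>\<in>P. cost n f \<omega>)"

text \<open>
  In the following, \<open>n\<close> is the linear size of the fractal and \<open>b\<close> the linear size of a block,
  so that \<open>n div b\<close> is the linear size of the coarsened fractal.
\<close>

definition lambda_space_of_size :: "nat \<Rightarrow> nat \<Rightarrow> nat \<Rightarrow> nat \<Rightarrow> (nat \<times> nat) set" where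
  "lambda_space_of_size s k b n = lambda_space k (level s (n div b))"

definition lambda_map_of_size ::
    "nat \<Rightarrow> nat \<Rightarrow> (nat \<Rightarrow> nat \<times> nat) \<Rightarrow> nat \<Rightarrow> nat \<Rightarrow> block_map" where
  "lambda_map_of_size s k \<tau> b n = lambda_map s k \<tau> (level s (n div b))"

definition W_BB :: "block_cost \<Rightarrow> nat \<Rightarrow> nat \<Rightarrow> real" where
  "W_BB cost b n = mapping_work cost n id (bb_space (n div b))"

definition W_lambda ::
    "block_cost \<Rightarrow> nat \<Rightarrow> nat \<Rightarrow> (nat \<Rightarrow> nat \<times> nat) \<Rightarrow> nat \<Rightarrow> nat \<Rightarrow> real" where
  "W_lambda cost s k \<tau> b n =
     mapping_work cost n (lambda_map_of_size s k \<tau> b n) (lambda_space_of_size s k b n)"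

definition S_lambda ::
    "block_cost \<Rightarrow> nat \<Rightarrow> nat \<Rightarrow> (nat \<Rightarrow> nat \<times> nat) \<Rightarrow> nat \<Rightarrow> nat \<Rightarrow> real" where
  "S_lambda cost s k \<tau> b n = W_BB cost b n / W_lambda cost s k \<tau> b n"


lemma level_power:
  assumes "s \<ge> 2"
  shows "level s (s ^ r) = r"
  unfolding level_def using assms by (intro the_equality) auto

lemma card_lambda_space: "card (lambda_space k r) = k ^ r"
proof -
  have "(r + 1) div 2 + r div 2 = r" by presburger
  then show ?thesis
    by (simp add: lambda_space_def card_cartesian_product flip: power_add)
qed

lemma card_lambda_space_dim:
  assumes "s \<ge> 2" "k \<ge> 1"
  shows "real (card (lambda_space k r)) = real (s ^ r) powr nbb_dim s k"
proof -
  have "real (s ^ r) powr nbb_dim s k = exp (real r * ln (real k))"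
    using assms by (simp add: powr_def nbb_dim_def ln_realpow)
  also have "\<dots> = real k ^ r"
    using assms by (simp add: exp_of_nat_mult)
  finally show ?thesis by (simp add: card_lambda_space)
qed

lemma digit_low:
  fixes k :: nat
  assumes "j < e" "k \<ge> 1"
  shows "((x + k ^ e * d) div k ^ j) mod k = (x div k ^ j) mod k"
proof -
  have e: "e = j + 1 + (e - j - 1)" using assms by simp
  have "k ^ e = k ^ j * k * k ^ (e - j - 1)"
    by (subst e) (simp only: power_add power_one_right)
  then have "x + k ^ e * d = x + k ^ j * (k * (k ^ (e - j - 1) * d))"
    by (simp only: mult.assoc)
  moreover have "(x + k ^ j * (k * y)) div k ^ j = x div k ^ j + k * y" for y
    using assms by simp
  ultimately show ?thesis by (simp only: mod_mult_self2)
qed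

lemma lambda_map_step:
  assumes k: "k \<ge> 1" and d: "d < k" and \<omega>: "(x, y) \<in> lambda_space k r"
  shows "lambda_map s k \<tau> (Suc r)
           (if even r then (x + k ^ (r div 2) * d, y) else (x, y + k ^ (r div 2) * d)) =
         lambda_map s k \<tau> r (x, y) + scale (s ^ r) (\<tau> d)" (is "lambda_map _ _ _ _ ?w = _")
proof -
  have old: "beta k \<mu> ?w = beta k \<mu> (x, y)" if "\<mu> \<in> {1..r}" for \<mu>
  proof (cases "even r = odd \<mu>")
    case True
    then have "(\<mu> + 1) div 2 - 1 < r div 2" using that by simp presburger
    from digit_low[OF this k] show ?thesis
      using True by (cases "even r") (auto simp: beta_def mod_2_eq_odd)
  next
    case False
    then show ?thesis by (cases "even r") (auto simp: beta_def mod_2_eq_odd)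
  qed
  have new: "beta k (Suc r) ?w = d"
  proof (cases "even r")
    case True
    then have "x < k ^ (r div 2)" using \<omega> by (auto simp: lambda_space_def)
    with True k d show ?thesis by (auto simp: beta_def mod_2_eq_odd)
  next
    case False
    then have "(r + 1 + 1) div 2 - 1 = r div 2" by presburger
    moreover have "y < k ^ (r div 2)" using \<omega> by (auto simp: lambda_space_def)
    ultimately show ?thesis using False k d by (auto simp: beta_def mod_2_eq_odd)
  qed
  have "lambda_map s k \<tau> (Suc r) ?w =
          (\<Sum>\<mu>=1..r. scale (s ^ (\<mu> - 1)) (\<tau> (beta k \<mu> ?w))) + scale (s ^ r) (\<tau> (beta k (Suc r) ?w))"
    by (simp add: lambda_map_def)
  also have "(\<Sum>\<mu>=1..r. scale (s ^ (\<mu> - 1)) (\<tau> (beta k \<mu> ?w))) = lambda_map s k \<tau> r (x, y)"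
    unfolding lambda_map_def by (intro sum.cong refl) (simp only: old)
  finally show ?thesis by (simp only: new)
qed

lemma add_mult_less:
  fixes x d k m :: nat
  assumes "x < m" "d < k"
  shows "x + m * d < k * m"
proof -
  have "x + m * d < m * Suc d" using assms by simp
  also have "\<dots> \<le> m * k" using assms by (intro mult_le_mono2) simp
  finally show ?thesis by (simp add: mult.commute)
qed

lemma lambda_space_Suc:
  assumes k: "k \<ge> 1"
  shows "lambda_space k (Suc r) =
     (\<Union>d<k. (\<lambda>(x, y). if even r then (x + k ^ (r div 2) * d, y) else (x, y + k ^ (r div 2) * d))
        ` lambda_space k r)" (is "_ = ?R")
proof -
  have split: "{..<k * m} = (\<Union>d<k. (\<lambda>x. x + m * d) ` {..<m})" if "m > 0" for m :: nat
  proof (intro equalityI subsetI)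
    fix z assume z: "z \<in> {..<k * m}"
    then have "z div m < k" using that by (simp add: less_mult_imp_div_less)
    moreover have "z = z mod m + m * (z div m)" "z mod m < m" using that by simp_all
    ultimately show "z \<in> (\<Union>d<k. (\<lambda>x. x + m * d) ` {..<m})" by blast
  qed (auto intro: add_mult_less)
  have m: "k ^ (r div 2) > 0" using k by simp
  show ?thesis
  proof (cases "even r")
    case True
    then have "lambda_space k (Suc r) = {..<k * k ^ (r div 2)} \<times> {..<k ^ (r div 2)}"
      "lambda_space k r = {..<k ^ (r div 2)} \<times> {..<k ^ (r div 2)}"
      by (auto simp: lambda_space_def)
    with True show ?thesis unfolding split[OF m] by (auto simp: image_iff)
  next
    case False
    then have "(Suc r + 1) div 2 = (r + 1) div 2" "Suc r div 2 = Suc (r div 2)" by presburger+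
    then have "lambda_space k (Suc r) = {..<k ^ ((r + 1) div 2)} \<times> {..<k * k ^ (r div 2)}"
      "lambda_space k r = {..<k ^ ((r + 1) div 2)} \<times> {..<k ^ (r div 2)}"
      by (simp_all add: lambda_space_def)
    with False show ?thesis unfolding split[OF m] by (auto simp: image_iff)
  qed
qed

theorem lambda_map_onto:
  assumes k: "k \<ge> 1"
  shows "lambda_map s k \<tau> r ` lambda_space k r = nbb_fractal s k \<tau> r"
proof (induction r)
  case 0
  show ?case by (auto simp: lambda_space_def lambda_map_def zero_prod_def)
next
  case (Suc r)
  have "lambda_map s k \<tau> (Suc r) ` lambda_space k (Suc r) =
      (\<Union>d<k. (\<lambda>\<omega>. lambda_map s k \<tau> r \<omega> + scale (s ^ r) (\<tau> d)) ` lambda_space k r)"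
    unfolding lambda_space_Suc[OF k] image_UN image_image
  proof (intro SUP_cong image_cong refl)
    fix d \<omega> assume "d \<in> {..<k}" "\<omega> \<in> lambda_space k r"
    then show "lambda_map s k \<tau> (Suc r) (case \<omega> of (x, y) \<Rightarrow>
        if even r then (x + k ^ (r div 2) * d, y) else (x, y + k ^ (r div 2) * d)) =
      lambda_map s k \<tau> r \<omega> + scale (s ^ r) (\<tau> d)"
      using lambda_map_step[OF k] by (cases \<omega>) auto
  qed
  also have "\<dots> = nbb_fractal s k \<tau> (Suc r)"
    by (simp add: Suc.IH[symmetric] image_image)
  finally show ?case .
qed

end

(*
  Both spaces are counted in blocks: the bounding box has (s^2)^j blocks and the parallel space of
  the map lambda has k^j, where s^j is the linear size of the coarsened fractal. Since k < s^2 the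
  ratio of the counts grows geometrically, and the double logarithm in the cost per block is
  already dominated by a linear function of the level r, where n = s^r.
*)

theory Submission
  imports Defs "HOL-Real_Asymp.Real_Asymp"
begin

lemma finite_lambda_space: "finite (lambda_space k r)"
  by (simp add: lambda_space_def)

lemma lambda_space_nonempty:
  assumes "k \<ge> 1"
  shows "lambda_space k r \<noteq> {}"
  using assms by (auto simp: lambda_space_def lessThan_empty_iff)

lemma W_BB_const:
  assumes "\<And>\<omega>. \<omega> \<in> bb_space (n div b) \<Longrightarrow> cost n id \<omega> = c"
  shows "W_BB cost b n = c * real (n div b) ^ 2"
proof -
  have "W_BB cost b n = (\<Sum>\<omega>\<in>bb_space (n div b). c)"
    unfolding W_BB_def mapping_work_def using assms by (intro sum.cong) auto
  then show ?thesis
    by (simp add: bb_space_def card_cartesian_product power2_eq_square)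
qed

lemma mapping_work_le_Max:
  assumes "finite P"
  shows "mapping_work cost n f P \<le> real (card P) * (MAX \<omega>\<in>P. cost n f \<omega>)"
  unfolding mapping_work_def using assms by (intro sum_bounded_above) simp

lemma mapping_work_pos:
  assumes "finite P" "P \<noteq> {}" "\<And>\<omega>. \<omega> \<in> P \<Longrightarrow> cost n f \<omega> > 0"
  shows "mapping_work cost n f P > 0"
  unfolding mapping_work_def using assms by (intro sum_pos)

text \<open>The inner logarithm is \<open>real r * log 2 (real s)\<close>, linear in
  \<open>r\<close> with a positive factor, so just one logarithm of \<open>r\<close>
  remains.\<close>

lemma log_log_power_bigo:
  assumes "s \<ge> 2"
  shows "(\<lambda>r. log 2 (log 2 (real (s ^ r)))) \<in> O(\<lambda>r. real r)"
proof -
  have "(\<lambda>r. log 2 (real r * a)) \<in> O(\<lambda>r. real r)" if "a > 0" for a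
    using that by real_asymp
  from this[of "log 2 (real s)"] show ?thesis
    using assms by (simp add: log_nat_power)
qed

text \<open>Admissible sizes are the powers of \<open>s\<close>, so the limit runs along the
  exponent \<open>r\<close>. Taking \<open>b = s ^ m\<close> keeps the coarsened size a power of
  \<open>s\<close> once \<open>r \<ge> m\<close>, and the maximum makes the cost bound uniform over
  all blocks.\<close>

theorem theorem2:
  fixes s k b m :: nat and \<tau> :: "nat \<Rightarrow> nat \<times> nat"
    and cost :: block_cost and c :: real
  assumes "nbb_family s k \<tau>" and "k < s ^ 2"
    and "b = s ^ m"
    and "c > 0"
    and "\<And>r \<omega>. r \<ge> m \<Longrightarrow> \<omega> \<in> bb_space (s ^ r div b) \<Longrightarrow> cost (s ^ r) id \<omega> = c"
    and "\<And>r \<omega>. r \<ge> m \<Longrightarrow> \<omega> \<in> lambda_space_of_size s k b (s ^ r) \<Longrightarrow>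
           cost (s ^ r) (lambda_map_of_size s k \<tau> b (s ^ r)) \<omega> > 0"
    and "(\<lambda>r. MAX \<omega>\<in>lambda_space_of_size s k b (s ^ r).
            cost (s ^ r) (lambda_map_of_size s k \<tau> b (s ^ r)) \<omega>)
         \<in> O(\<lambda>r. log 2 (log 2 (real (s ^ r))))"
  shows "filterlim (\<lambda>r. S_lambda cost s k \<tau> b (s ^ r)) at_top sequentially"
proof -
  have s: "s \<ge> 2" and k: "k \<ge> 1"
    using assms(1) by (auto simp: nbb_family_def)
  define cost_max where "cost_max r = (MAX \<omega>\<in>lambda_space_of_size s k b (s ^ r).
    cost (s ^ r) (lambda_map_of_size s k \<tau> b (s ^ r)) \<omega>)" for r
  have "cost_max \<in> O(\<lambda>r. real r)"
    using landau_o.big.trans[OF assms(7) log_log_power_bigo[OF s]] by (simp add: cost_max_def[abs_def])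
  then obtain C where C: "C > 0" "\<forall>\<^sub>F r in sequentially. norm (cost_max r) \<le> C * norm (real r)"
    by (elim landau_o.bigE)
  \<comment> \<open>The factor by which the ratio of the two block counts grows per level.\<close>
  define q where "q = real s ^ 2 / real k"
  have "real k < real s ^ 2"
    using assms(2) by (metis of_nat_less_iff of_nat_power)
  then have q: "q > 1"
    using k by (simp add: q_def)
  \<comment> \<open>The true exponent is \<open>r - m\<close>; the shift is absorbed into the
    constant \<open>q ^ m\<close>, leaving an exponential over a linear function.\<close>
  have "\<forall>\<^sub>F r in sequentially. c / (C * q ^ m) * q ^ r / real r \<le> S_lambda cost s k \<tau> b (s ^ r)"
    using C(2) eventually_ge_at_top[of m] eventually_gt_at_top[of 0]
  proof eventually_elim
    case (elim r)
    let ?j = "r - m"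
    have j: "s ^ r div b = s ^ ?j"
      using s elim(2) assms(3) by (simp add: power_diff)
    have space: "lambda_space_of_size s k b (s ^ r) = lambda_space k ?j"
      by (simp add: lambda_space_of_size_def j level_power[OF s])
    \<comment> \<open>Written with base \<open>s ^ 2\<close> so that division by
      \<open>k ^ ?j\<close> yields \<open>q ^ ?j\<close>.\<close>
    have BB: "W_BB cost b (s ^ r) = c * (real s ^ 2) ^ ?j"
      using W_BB_const[of "s ^ r" b cost c, OF assms(5)[OF elim(2)]]
      by (simp add: j flip: power_mult) (simp add: mult.commute)
    \<comment> \<open>An upper bound on a denominator bounds the quotient from below only if the
      denominator is positive.\<close>
    have pos: "W_lambda cost s k \<tau> b (s ^ r) > 0"
      unfolding W_lambda_def using assms(6)[OF elim(2)] finite_lambda_space lambda_space_nonempty[OF k]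
      by (intro mapping_work_pos) (auto simp: space)
    have "W_lambda cost s k \<tau> b (s ^ r) \<le> real (k ^ ?j) * cost_max r"
      using mapping_work_le_Max[OF finite_lambda_space]
      unfolding W_lambda_def cost_max_def space by (metis card_lambda_space)
    also have "\<dots> \<le> real (k ^ ?j) * (C * real r)"
      using elim(1) by (intro mult_left_mono) auto
    finally have W: "W_lambda cost s k \<tau> b (s ^ r) \<le> real (k ^ ?j) * (C * real r)" .
    have "c / (C * q ^ m) * q ^ r / real r = c / C * q ^ ?j / real r"
      using q elim(2) by (simp add: power_diff)
    also have "\<dots> = c * (real s ^ 2) ^ ?j / (real (k ^ ?j) * (C * real r))"
      by (simp add: q_def power_divide)
    \<comment> \<open>Here \<open>r > 0\<close> makes the larger denominator positive as
      well.\<close>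
    also have "\<dots> \<le> c * (real s ^ 2) ^ ?j / W_lambda cost s k \<tau> b (s ^ r)"
      using W pos assms(4) k C(1) elim(3) by (intro divide_left_mono mult_pos_pos) auto
    finally show ?case
      by (simp add: S_lambda_def BB)
  qed
  moreover have "filterlim (\<lambda>r. c / (C * q ^ m) * q ^ r / real r) at_top sequentially"
    using q C(1) assms(4) by real_asymp
  ultimately show ?thesis
    by (rule filterlim_at_top_mono[rotated])
qed

end
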